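(* The variety of mono symmetric Zinbiel algebras over $\mathbb{C}$ coincides with the variety of mono symmetric Leibniz algebras over $\mathbb{C}$, and it is defined by the identities $x^2x=0$, $xx^2=0$, $x^2x^2=0$.
   Context: Algebras are over $\mathbb{C}$ and not assumed associative; $x^2=xx$. An algebra is symmetric Zinbiel if $(xy)z=x(yz)+x(zy)$ and $x(yz)=(xy)z+(yx)z$ for all $x,y,z$. An algebra is symmetric Leibniz if it is both left Leibniz, $x(yz)=(xy)z+y(xz)$, and right Leibniz, $(xy)z=(xz)y+x(yz)$, for all $x,y,z$. For a variety $\Omega$ of algebras, an algebra is called mono-$\Omega$ if each of its one-generated subalgebras belongs to $\Omega$. *)

theory Defs
  imports Complex_Main "HOL-Algebra.Algebraic_Closure_Type"
begin

abbreviation complex_ring :: "complex ring" where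
  "complex_ring \<equiv> ring_of_type_algebra"

(* An algebra over the complex numbers: a vector space with a bilinear product, with no associativity,
   commutativity or unit assumed.  The locale algebra of HOL-Algebra requires a commutative ring, so only
   its module part is reused; the field one of the record A is unconstrained and plays no role. *)
locale nonassoc_algebra = module complex_ring A for A (structure) +
  assumes mult_closed: "x \<in> carrier A \<Longrightarrow> y \<in> carrier A \<Longrightarrow> x \<otimes> y \<in> carrier A"
    and mult_add_left: "x \<in> carrier A \<Longrightarrow> y \<in> carrier A \<Longrightarrow> z \<in> carrier A \<Longrightarrow>
      (x \<oplus> y) \<otimes> z = x \<otimes> z \<oplus> y \<otimes> z"
    and mult_add_right: "x \<in> carrier A \<Longrightarrow> y \<in> carrier A \<Longrightarrow> z \<in> carrier A \<Longrightarrow>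
      x \<otimes> (y \<oplus> z) = x \<otimes> y \<oplus> x \<otimes> z"
    and mult_smult_left: "x \<in> carrier A \<Longrightarrow> y \<in> carrier A \<Longrightarrow>
      (c \<odot> x) \<otimes> y = c \<odot> (x \<otimes> y)"
    and mult_smult_right: "x \<in> carrier A \<Longrightarrow> y \<in> carrier A \<Longrightarrow>
      x \<otimes> (c \<odot> y) = c \<odot> (x \<otimes> y)"

definition nonassoc_subalgebra :: "'a set \<Rightarrow> (complex, 'a) module \<Rightarrow> bool" where
  "nonassoc_subalgebra H A \<longleftrightarrow>
     submodule H complex_ring A \<and> (\<forall>x\<in>H. \<forall>y\<in>H. x \<otimes>\<^bsub>A\<^esub> y \<in> H)"

definition one_generated :: "(complex, 'a) module \<Rightarrow> 'a \<Rightarrow> (complex, 'a) module" where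
  "one_generated A x = A\<lparr>carrier := \<Inter>{H. nonassoc_subalgebra H A \<and> x \<in> H}\<rparr>"

(* Nonassociative polynomials; an identity is a pair (s, t), read as s = t. *)
datatype poly_term =
    Var nat
  | Zero
  | Add poly_term poly_term
  | Scale complex poly_term
  | Mul poly_term poly_term

fun eval_term :: "(complex, 'a) module \<Rightarrow> (nat \<Rightarrow> 'a) \<Rightarrow> poly_term \<Rightarrow> 'a" where
  "eval_term A v (Var n) = v n"
| "eval_term A v Zero = \<zero>\<^bsub>A\<^esub>"
| "eval_term A v (Add s t) = eval_term A v s \<oplus>\<^bsub>A\<^esub> eval_term A v t"
| "eval_term A v (Scale c t) = c \<odot>\<^bsub>A\<^esub> eval_term A v t"
| "eval_term A v (Mul s t) = eval_term A v s \<otimes>\<^bsub>A\<^esub> eval_term A v t"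

definition satisfies :: "(complex, 'a) module \<Rightarrow> poly_term \<times> poly_term \<Rightarrow> bool" where
  "satisfies A e \<longleftrightarrow>
     (\<forall>v. range v \<subseteq> carrier A \<longrightarrow> eval_term A v (fst e) = eval_term A v (snd e))"

definition variety :: "(poly_term \<times> poly_term) set \<Rightarrow> (complex, 'a) module set" where
  "variety I = {A. nonassoc_algebra A \<and> (\<forall>e\<in>I. satisfies A e)}"

definition mono_class :: "(complex, 'a) module set \<Rightarrow> (complex, 'a) module set" where
  "mono_class \<Omega> = {A. nonassoc_algebra A \<and> (\<forall>x\<in>carrier A. one_generated A x \<in> \<Omega>)}"

definition symmetric_zinbiel :: "(complex, 'a) module set" where
  "symmetric_zinbiel =
     (let x = Var 0; y = Var 1; z = Var 2 in
      variety
       {(Mul (Mul x y) z, Add (Mul x (Mul y z)) (Mul x (Mul z y))),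
        (Mul x (Mul y z), Add (Mul (Mul x y) z) (Mul (Mul y x) z))})"

definition symmetric_leibniz :: "(complex, 'a) module set" where
  "symmetric_leibniz =
     (let x = Var 0; y = Var 1; z = Var 2 in
      variety
       {(Mul x (Mul y z), Add (Mul (Mul x y) z) (Mul y (Mul x z))),
        (Mul (Mul x y) z, Add (Mul (Mul x z) y) (Mul x (Mul y z)))})"

lemma valuation3_iff:
  "(\<forall>v::nat \<Rightarrow> 'a. range v \<subseteq> S \<longrightarrow> P (v 0) (v 1) (v 2)) \<longleftrightarrow>
   (\<forall>x\<in>S. \<forall>y\<in>S. \<forall>z\<in>S. P x y z)" (is "?L \<longleftrightarrow> ?R")
proof
  assume L: ?L
  show ?R
  proof (intro ballI)
    fix x y z assume S: "x \<in> S" "y \<in> S" "z \<in> S"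
    define v :: "nat \<Rightarrow> 'a" where "v n = (if n = 0 then x else if n = 1 then y else z)" for n
    have "range v \<subseteq> S" using S by (auto simp: v_def)
    then have "P (v 0) (v 1) (v 2)" using L by blast
    then show "P x y z" by (simp add: v_def)
  qed
next
  assume ?R
  then show ?L by (meson range_subsetD)
qed

lemma mem_symmetric_zinbiel_iff:
  "A \<in> symmetric_zinbiel \<longleftrightarrow> nonassoc_algebra A \<and>
     (\<forall>x\<in>carrier A. \<forall>y\<in>carrier A. \<forall>z\<in>carrier A.
        (x \<otimes>\<^bsub>A\<^esub> y) \<otimes>\<^bsub>A\<^esub> z = x \<otimes>\<^bsub>A\<^esub> (y \<otimes>\<^bsub>A\<^esub> z) \<oplus>\<^bsub>A\<^esub> x \<otimes>\<^bsub>A\<^esub> (z \<otimes>\<^bsub>A\<^esub> y)) \<and>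
     (\<forall>x\<in>carrier A. \<forall>y\<in>carrier A. \<forall>z\<in>carrier A.
        x \<otimes>\<^bsub>A\<^esub> (y \<otimes>\<^bsub>A\<^esub> z) = (x \<otimes>\<^bsub>A\<^esub> y) \<otimes>\<^bsub>A\<^esub> z \<oplus>\<^bsub>A\<^esub> (y \<otimes>\<^bsub>A\<^esub> x) \<otimes>\<^bsub>A\<^esub> z)"
  unfolding valuation3_iff [symmetric]
  by (simp add: symmetric_zinbiel_def variety_def satisfies_def Let_def)

lemma mem_symmetric_leibniz_iff:
  "A \<in> symmetric_leibniz \<longleftrightarrow> nonassoc_algebra A \<and>
     (\<forall>x\<in>carrier A. \<forall>y\<in>carrier A. \<forall>z\<in>carrier A.
        x \<otimes>\<^bsub>A\<^esub> (y \<otimes>\<^bsub>A\<^esub> z) = (x \<otimes>\<^bsub>A\<^esub> y) \<otimes>\<^bsub>A\<^esub> z \<oplus>\<^bsub>A\<^esub> y \<otimes>\<^bsub>A\<^esub> (x \<otimes>\<^bsub>A\<^esub> z)) \<and>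
     (\<forall>x\<in>carrier A. \<forall>y\<in>carrier A. \<forall>z\<in>carrier A.
        (x \<otimes>\<^bsub>A\<^esub> y) \<otimes>\<^bsub>A\<^esub> z = (x \<otimes>\<^bsub>A\<^esub> z) \<otimes>\<^bsub>A\<^esub> y \<oplus>\<^bsub>A\<^esub> x \<otimes>\<^bsub>A\<^esub> (y \<otimes>\<^bsub>A\<^esub> z))"
  unfolding valuation3_iff [symmetric]
  by (simp add: symmetric_leibniz_def variety_def satisfies_def Let_def)

end

theory Submission
  imports Defs
begin

text \<open>
  Both pairs of identities force \<open>x\<^sup>2x = xx\<^sup>2 = 0\<close>, and then \<open>x\<^sup>2x\<^sup>2 = 0\<close>, on substituting
  \<open>x\<close> and \<open>x\<^sup>2\<close>. Conversely, if these three products vanish, then the span of \<open>x\<close> and \<open>x\<^sup>2\<close> is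
  a subalgebra in which every product of three elements is zero, so that any identity between
  such products holds in the subalgebra generated by \<open>x\<close>.
\<close>

lemma complex_ring_simps [simp]:
  "carrier complex_ring = UNIV"
  "x \<oplus>\<^bsub>complex_ring\<^esub> y = x + y"
  "x \<otimes>\<^bsub>complex_ring\<^esub> y = x * y"
  "\<one>\<^bsub>complex_ring\<^esub> = 1"
  "\<zero>\<^bsub>complex_ring\<^esub> = 0"
  by (simp_all add: ring_of_type_algebra_def)

lemma valuation1_iff:
  "(\<forall>v::nat \<Rightarrow> 'a. range v \<subseteq> S \<longrightarrow> P (v 0)) \<longleftrightarrow> (\<forall>x\<in>S. P x)"
  using valuation3_iff [of S "\<lambda>x y z. P x"] by blast

section \<open>Scalar arithmetic in an algebra over the complex numbers\<close>

context nonassoc_algebra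
begin

lemma smult_mem [simp, intro]: "x \<in> carrier A \<Longrightarrow> c \<odot> x \<in> carrier A"
  using smult_closed by simp

lemma smult_zero [simp]: "x \<in> carrier A \<Longrightarrow> 0 \<odot> x = \<zero>"
  using smult_l_null by simp

lemma smult_unit [simp]: "x \<in> carrier A \<Longrightarrow> 1 \<odot> x = x"
  using smult_one by simp

text \<open>Rewriting \<open>\<zero>\<close> as \<open>0 \<odot> \<zero>\<close> and pulling the
  scalar out of the product leaves a zero multiple.\<close>

lemma mult_zero_left [simp]:
  assumes "x \<in> carrier A"
  shows "\<zero> \<otimes> x = \<zero>"
  using mult_smult_left [of \<zero> x 0] assms by (simp add: mult_closed)

lemma mult_zero_right [simp]:
  assumes "x \<in> carrier A"
  shows "x \<otimes> \<zero> = \<zero>"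
  using mult_smult_right [of x \<zero> 0] assms by (simp add: mult_closed)

text \<open>Substitution gives \<open>p = 4 \<odot> p\<close>, hence
  \<open>3 \<odot> p = \<zero>\<close>, and 3 is invertible. The Zinbiel identities with all
  variables equal have this shape, \<open>p\<close> and \<open>q\<close> being the two cubes of an
  element.\<close>

lemma eq_double_double_imp_zero:
  assumes p: "p \<in> carrier A" and "q = p \<oplus> p" "p = q \<oplus> q"
  shows "p = \<zero>"
proof -
  have dbl: "r \<oplus> r = 2 \<odot> r" if "r \<in> carrier A" for r
    using smult_l_distr [of 1 1 r] that by simp
  have "p = (p \<oplus> p) \<oplus> (p \<oplus> p)"
    by (rule assms(3) [unfolded assms(2)])
  also have "\<dots> = 4 \<odot> p"
    using p smult_assoc1 [of 2 2 p] by (simp add: dbl)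
  also have "\<dots> = p \<oplus> 3 \<odot> p"
    using smult_l_distr [of 1 3 p] p by simp
  finally have "3 \<odot> p = \<zero>"
    using M.add.l_cancel_one' [of p "3 \<odot> p"] p by blast
  then show ?thesis
    using smult_assoc1 [of "1/3" 3 p] smult_r_null [of "1/3"] p by simp
qed

lemma add_smult_interchange:
  assumes "x \<in> carrier A" "y \<in> carrier A"
  shows "(a \<odot> x \<oplus> b \<odot> y) \<oplus> (c \<odot> x \<oplus> d \<odot> y) = (a + c) \<odot> x \<oplus> (b + d) \<odot> y"
  using assms smult_l_distr [of a c x] smult_l_distr [of b d y]
  by (simp add: M.a_ac)

end

section \<open>Subalgebras and the subalgebra generated by one element\<close>

text \<open>The subalgebra notions of the definitions exclude record extensions of the module type.\<close>

locale module_algebra = nonassoc_algebra A for A :: "(complex, 'a) module" (structure)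
begin

lemma nonassoc_algebra_subalgebra:
  assumes "nonassoc_subalgebra H A"
  shows "nonassoc_algebra (A\<lparr>carrier := H\<rparr>)"
proof -
  have sub: "submodule H complex_ring A" and mult: "\<And>x y. x \<in> H \<Longrightarrow> y \<in> H \<Longrightarrow> x \<otimes> y \<in> H"
    using assms by (auto simp: nonassoc_subalgebra_def)
  have "module complex_ring (A\<lparr>carrier := H\<rparr>)"
    by (rule submodule.submodule_is_module [OF sub module_axioms])
  moreover have "H \<subseteq> carrier A" by (rule submoduleE(1) [OF sub])
  ultimately show ?thesis
    unfolding nonassoc_algebra_def nonassoc_algebra_axioms_def
    by (auto simp: mult mult_add_left mult_add_right mult_smult_left mult_smult_right subset_iff)
qed

lemma nonassoc_subalgebra_carrier: "nonassoc_subalgebra (carrier A) A"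
  by (simp add: nonassoc_subalgebra_def carrier_is_submodule mult_closed)

text \<open>Nonemptiness keeps the intersection inside \<open>carrier A\<close>: the empty
  intersection would be the whole type.\<close>

lemma nonassoc_subalgebra_Inter:
  assumes "\<H> \<noteq> {}" and "\<And>H. H \<in> \<H> \<Longrightarrow> nonassoc_subalgebra H A"
  shows "nonassoc_subalgebra (\<Inter>\<H>) A"
proof -
  have sub: "submodule H complex_ring A" if "H \<in> \<H>" for H
    using assms(2) [OF that] by (simp add: nonassoc_subalgebra_def)
  have zero: "\<zero> \<in> H" if "H \<in> \<H>" for H
    using submodule.axioms(1) [OF sub [OF that]] subgroup.one_closed by fastforce
  have "submodule (\<Inter>\<H>) complex_ring A"
  proof (rule submoduleI)
    show "\<Inter>\<H> \<subseteq> carrier A"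
      using assms(1) submoduleE(1) [OF sub] by blast
  qed (use zero submoduleE(3-5) [OF sub] in auto)
  then show ?thesis
    using assms(2) by (auto simp: nonassoc_subalgebra_def)
qed

text \<open>The family being intersected is nonempty because \<open>carrier A\<close> belongs to
  it.\<close>

lemma nonassoc_subalgebra_one_generated:
  assumes "x \<in> carrier A"
  shows "nonassoc_subalgebra (carrier (one_generated A x)) A"
  unfolding one_generated_def using assms nonassoc_subalgebra_carrier
  by (auto intro!: nonassoc_subalgebra_Inter)

lemma nonassoc_algebra_one_generated:
  assumes "x \<in> carrier A"
  shows "nonassoc_algebra (one_generated A x)"
  using nonassoc_algebra_subalgebra [OF nonassoc_subalgebra_one_generated [OF assms]]
  by (simp add: one_generated_def)

end

lemma one_generated_simps [simp]:
  "x \<otimes>\<^bsub>one_generated A a\<^esub> y = x \<otimes>\<^bsub>A\<^esub> y"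
  "x \<oplus>\<^bsub>one_generated A a\<^esub> y = x \<oplus>\<^bsub>A\<^esub> y"
  by (simp_all add: one_generated_def)

lemma generator_mem_one_generated: "x \<in> carrier (one_generated A x)"
  by (simp add: one_generated_def)

lemma square_mem_one_generated: "x \<otimes>\<^bsub>A\<^esub> x \<in> carrier (one_generated A x)"
  by (auto simp: one_generated_def nonassoc_subalgebra_def)

lemma one_generated_least:
  "nonassoc_subalgebra H A \<Longrightarrow> x \<in> H \<Longrightarrow> carrier (one_generated A x) \<subseteq> H"
  by (auto simp: one_generated_def)

section \<open>The span of an element and its square\<close>

context module_algebra
begin

context
  fixes x
  assumes x: "x \<in> carrier A"
    and sq_left: "(x \<otimes> x) \<otimes> x = \<zero>"
    and sq_right: "x \<otimes> (x \<otimes> x) = \<zero>"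
    and sq_sq: "(x \<otimes> x) \<otimes> (x \<otimes> x) = \<zero>"
begin

text \<open>Linear independence is not claimed: the square may vanish, so the coefficients need not
  be unique.\<close>

definition square_span :: "'a set" where
  "square_span = {a \<odot> x \<oplus> b \<odot> (x \<otimes> x) | a b. True}"

lemma square_mem: "x \<otimes> x \<in> carrier A"
  using x mult_closed by simp

lemma square_span_subset: "square_span \<subseteq> carrier A"
  using x square_mem by (auto simp: square_span_def)

text \<open>Of the four products in the bilinear expansion, three vanish by the assumptions on
  \<open>x\<close>; only \<open>x \<otimes> x\<close> survives.\<close>

lemma square_span_mult:
  "(a \<odot> x \<oplus> b \<odot> (x \<otimes> x)) \<otimes> (c \<odot> x \<oplus> d \<odot> (x \<otimes> x)) = (c * a) \<odot> (x \<otimes> x)"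
  using x square_mem smult_assoc1 [of c a "x \<otimes> x"]
  by (simp add: mult_add_left mult_add_right mult_smult_left mult_smult_right
      sq_left sq_right sq_sq)

lemma smult_square_mem_square_span: "c \<odot> (x \<otimes> x) \<in> square_span"
proof -
  have "c \<odot> (x \<otimes> x) = 0 \<odot> x \<oplus> c \<odot> (x \<otimes> x)"
    using x square_mem by simp
  then show ?thesis unfolding square_span_def by blast
qed

lemma nonassoc_subalgebra_square_span: "nonassoc_subalgebra square_span A"
proof -
  have smult: "c \<odot> u \<in> square_span" if "u \<in> square_span" for c u
  proof -
    obtain a b where "u = a \<odot> x \<oplus> b \<odot> (x \<otimes> x)" using \<open>u \<in> square_span\<close>
      by (auto simp: square_span_def)
    then have "c \<odot> u = (c * a) \<odot> x \<oplus> (c * b) \<odot> (x \<otimes> x)"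
      using x square_mem smult_r_distr [of c "a \<odot> x" "b \<odot> (x \<otimes> x)"]
        smult_assoc1 [of c a x] smult_assoc1 [of c b "x \<otimes> x"] by simp
    then show ?thesis unfolding square_span_def by blast
  qed
  have "submodule square_span complex_ring A"
  proof (rule submoduleI)
    show "\<zero> \<in> square_span"
      using smult_square_mem_square_span [of 0] smult_l_null [OF square_mem] by simp
    show "\<ominus> u \<in> square_span" if "u \<in> square_span" for u
    proof -
      have u: "u \<in> carrier A" using that square_span_subset by blast
      \<comment> \<open>Closure under negation reduces to closure under scaling by -1.\<close>
      have "u \<oplus> (-1) \<odot> u = \<zero>"
        using u smult_l_distr [of 1 "-1" u] by simp
      then have "\<ominus> u = (-1) \<odot> u"
        using u by (metis M.minus_equality M.a_comm smult_mem)
      then show ?thesis using smult that by simp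
    qed
    show "u \<oplus> v \<in> square_span" if "u \<in> square_span" "v \<in> square_span" for u v
      using that add_smult_interchange [OF x square_mem] unfolding square_span_def by blast
  qed (use square_span_subset smult in auto)
  moreover have "u \<otimes> v \<in> square_span" if "u \<in> square_span" "v \<in> square_span" for u v
    using that square_span_mult smult_square_mem_square_span by (auto simp: square_span_def)
  ultimately show ?thesis by (simp add: nonassoc_subalgebra_def)
qed

lemma generator_mem_square_span: "x \<in> square_span"
proof -
  have "x = 1 \<odot> x \<oplus> 0 \<odot> (x \<otimes> x)"
    using x square_mem by simp
  then show ?thesis unfolding square_span_def by blast
qed

lemma square_span_mult_square:
  assumes "u \<in> square_span"
  shows "u \<otimes> (c \<odot> (x \<otimes> x)) = \<zero>" and "(c \<odot> (x \<otimes> x)) \<otimes> u = \<zero>"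
proof -
  obtain a b where u: "u = a \<odot> x \<oplus> b \<odot> (x \<otimes> x)" using assms by (auto simp: square_span_def)
  \<comment> \<open>The product formula sees only the coefficients of \<open>x\<close>; here that
    coefficient is 0, so multiples of the square annihilate the span from both sides.\<close>
  have eq: "c \<odot> (x \<otimes> x) = 0 \<odot> x \<oplus> c \<odot> (x \<otimes> x)"
    using x square_mem by simp
  show "u \<otimes> (c \<odot> (x \<otimes> x)) = \<zero>" "(c \<odot> (x \<otimes> x)) \<otimes> u = \<zero>"
    using square_span_mult [of a b 0 c] square_span_mult [of 0 c a b] square_mem
    by (simp_all flip: u eq)
qed

text \<open>By minimality all three elements lie in \<open>square_span\<close>. The inner product is
  then a multiple of the square, which the remaining factor kills.\<close>

lemma one_generated_triple_products:
  assumes "u \<in> carrier (one_generated A x)" "v \<in> carrier (one_generated A x)"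
    "w \<in> carrier (one_generated A x)"
  shows "u \<otimes> (v \<otimes> w) = \<zero>" and "(u \<otimes> v) \<otimes> w = \<zero>"
proof -
  have mem: "u \<in> square_span" "v \<in> square_span" "w \<in> square_span"
    using assms one_generated_least [OF nonassoc_subalgebra_square_span generator_mem_square_span]
    by auto
  have "\<exists>c. s \<otimes> t = c \<odot> (x \<otimes> x)" if "s \<in> square_span" "t \<in> square_span" for s t
    using that square_span_mult by (auto simp: square_span_def)
  then obtain c d where "u \<otimes> v = c \<odot> (x \<otimes> x)" "v \<otimes> w = d \<odot> (x \<otimes> x)"
    using mem by meson
  then show "u \<otimes> (v \<otimes> w) = \<zero>" "(u \<otimes> v) \<otimes> w = \<zero>"
    using mem square_span_mult_square by simp_all
qed

text \<open>Every term of the defining identities is a triple product, so each identity reads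
  \<open>\<zero> = \<zero> \<oplus> \<zero>\<close>.\<close>

lemma one_generated_mem_symmetric:
  "one_generated A x \<in> symmetric_zinbiel" "one_generated A x \<in> symmetric_leibniz"
  unfolding mem_symmetric_zinbiel_iff mem_symmetric_leibniz_iff
  using one_generated_triple_products nonassoc_algebra_one_generated [OF x] by simp_all

end

section \<open>The identities forced by membership in either variety\<close>

lemma symmetric_zinbiel_one_generated_imp:
  assumes x: "x \<in> carrier A" and "one_generated A x \<in> symmetric_zinbiel"
  shows "(x \<otimes> x) \<otimes> x = \<zero> \<and> x \<otimes> (x \<otimes> x) = \<zero> \<and> (x \<otimes> x) \<otimes> (x \<otimes> x) = \<zero>"
proof -
  note gen = generator_mem_one_generated [of x A] square_mem_one_generated [of A x]
  have left: "(u \<otimes> v) \<otimes> w = u \<otimes> (v \<otimes> w) \<oplus> u \<otimes> (w \<otimes> v)"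
    and right: "u \<otimes> (v \<otimes> w) = (u \<otimes> v) \<otimes> w \<oplus> (v \<otimes> u) \<otimes> w"
    if "u \<in> carrier (one_generated A x)" "v \<in> carrier (one_generated A x)"
      "w \<in> carrier (one_generated A x)" for u v w
    using assms(2) that unfolding mem_symmetric_zinbiel_iff one_generated_simps by blast+
  have c: "(x \<otimes> x) \<otimes> x \<in> carrier A" using x mult_closed by simp
  have l: "(x \<otimes> x) \<otimes> x = \<zero>"
    by (rule eq_double_double_imp_zero [OF c right [OF gen(1) gen(1) gen(1)]
          left [OF gen(1) gen(1) gen(1)]])
  have r: "x \<otimes> (x \<otimes> x) = \<zero>"
    using right [OF gen(1) gen(1) gen(1)] l by simp
  show ?thesis
    \<comment> \<open>Taking \<open>w\<close> to be the square of \<open>x\<close> splits the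
      product of squares into two terms, each containing a vanishing cube.\<close>
    using left [OF gen(1) gen(1) gen(2)] l r x by simp
qed

lemma symmetric_leibniz_one_generated_imp:
  assumes x: "x \<in> carrier A" and "one_generated A x \<in> symmetric_leibniz"
  shows "(x \<otimes> x) \<otimes> x = \<zero> \<and> x \<otimes> (x \<otimes> x) = \<zero> \<and> (x \<otimes> x) \<otimes> (x \<otimes> x) = \<zero>"
proof -
  note gen = generator_mem_one_generated [of x A] square_mem_one_generated [of A x]
  have left: "u \<otimes> (v \<otimes> w) = (u \<otimes> v) \<otimes> w \<oplus> v \<otimes> (u \<otimes> w)"
    and right: "(u \<otimes> v) \<otimes> w = (u \<otimes> w) \<otimes> v \<oplus> u \<otimes> (v \<otimes> w)"
    if "u \<in> carrier (one_generated A x)" "v \<in> carrier (one_generated A x)"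
      "w \<in> carrier (one_generated A x)" for u v w
    using assms(2) that unfolding mem_symmetric_leibniz_iff one_generated_simps by blast+
  have c: "(x \<otimes> x) \<otimes> x \<in> carrier A" "x \<otimes> (x \<otimes> x) \<in> carrier A" using x mult_closed by simp_all
  \<comment> \<open>With all variables equal, one term of each Leibniz identity repeats its left
    side; cancelling it leaves the other cube equal to zero.\<close>
  have l: "(x \<otimes> x) \<otimes> x = \<zero>"
    using M.add.r_cancel_one' [OF c(2) c(1)] left [OF gen(1) gen(1) gen(1)] by blast
  have r: "x \<otimes> (x \<otimes> x) = \<zero>"
    using M.add.l_cancel_one' [OF c(1) c(2)] right [OF gen(1) gen(1) gen(1)] by blast
  show ?thesis
    \<comment> \<open>With the square as first factor, both terms on the right contain the cube
      shown zero in \<open>l\<close>.\<close>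
    using left [OF gen(2) gen(1) gen(1)] l r x by simp
qed

lemma one_generated_mem_symmetric_iff:
  assumes "x \<in> carrier A"
  shows "one_generated A x \<in> symmetric_zinbiel \<longleftrightarrow>
      (x \<otimes> x) \<otimes> x = \<zero> \<and> x \<otimes> (x \<otimes> x) = \<zero> \<and> (x \<otimes> x) \<otimes> (x \<otimes> x) = \<zero>"
    "one_generated A x \<in> symmetric_leibniz \<longleftrightarrow>
      (x \<otimes> x) \<otimes> x = \<zero> \<and> x \<otimes> (x \<otimes> x) = \<zero> \<and> (x \<otimes> x) \<otimes> (x \<otimes> x) = \<zero>"
  using symmetric_zinbiel_one_generated_imp [OF assms] one_generated_mem_symmetric(1) [OF assms]
    symmetric_leibniz_one_generated_imp [OF assms] one_generated_mem_symmetric(2) [OF assms]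
  by blast+

end

theorem proposition20:
  shows "(mono_class symmetric_zinbiel :: (complex, 'a) module set) = mono_class symmetric_leibniz \<and>
         (mono_class symmetric_zinbiel :: (complex, 'a) module set) =
           (let x = Var 0; sq = Mul x x in
            variety {(Mul sq x, Zero), (Mul x sq, Zero), (Mul sq sq, Zero)})"
proof -
  let ?V = "let x = Var 0; sq = Mul x x in
    variety {(Mul sq x, Zero), (Mul x sq, Zero), (Mul sq sq, Zero)} :: (complex, 'a) module set"
  have V: "A \<in> ?V \<longleftrightarrow> nonassoc_algebra A \<and> (\<forall>x\<in>carrier A.
      (x \<otimes>\<^bsub>A\<^esub> x) \<otimes>\<^bsub>A\<^esub> x = \<zero>\<^bsub>A\<^esub> \<and> x \<otimes>\<^bsub>A\<^esub> (x \<otimes>\<^bsub>A\<^esub> x) = \<zero>\<^bsub>A\<^esub> \<and>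
      (x \<otimes>\<^bsub>A\<^esub> x) \<otimes>\<^bsub>A\<^esub> (x \<otimes>\<^bsub>A\<^esub> x) = \<zero>\<^bsub>A\<^esub>)" for A :: "(complex, 'a) module"
    \<comment> \<open>Only \<open>Var 0\<close> occurs, so valuations amount to single elements; the
      conjunction is then split into the three identities.\<close>
    unfolding valuation1_iff [symmetric]
    by (simp add: variety_def satisfies_def Let_def imp_conjR all_conj_distrib)
  have "A \<in> mono_class symmetric_zinbiel \<longleftrightarrow> A \<in> ?V"
    "A \<in> mono_class symmetric_leibniz \<longleftrightarrow> A \<in> ?V" for A :: "(complex, 'a) module"
    unfolding V mono_class_def mem_Collect_eq
    \<comment> \<open>The congruence rules supply \<open>nonassoc_algebra A\<close> and
      \<open>x \<in> carrier A\<close>, reducing the claim to one generator at a time.\<close>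
    by (intro conj_cong ball_cong refl module_algebra.one_generated_mem_symmetric_iff
        module_algebra.intro; assumption)+
  then show ?thesis by blast
qed

end
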